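(* Let $r,s>0$, let $a,b,c,d\ge -1$ be real, and let $n>1$ be an integer. Let $R=R^{(s,c,d;r,a,b)}_{n}=\mathcal{B}^{c,d}_s\circ B_n\circ\mathcal{B}^{a,b}_r : C[0,1]\to C[0,1]$ be the Bernstein-Euler-Jacobi operator of type II, and put $T(f,g;x):=R(fg;x)-R(f;x)\,R(g;x)$. Then for all $f,g\in C[0,1]$ and every fixed $x\in[0,1]$, $$|T(f,g;x)|\le \frac14\,\widetilde{\omega}\left(f;2\sqrt{R^{(s,c,d;r,a,b)}_{n}((e_1-x)^2;x)}\right)\cdot\widetilde{\omega}\left(g;2\sqrt{R^{(s,c,d;r,a,b)}_{n}((e_1-x)^2;x)}\right).$$
   Context: All functions are real-valued. For an operator $H:C[0,1]\to C[0,1]$ write $H(f;x):=(Hf)(x)$. Let $e_i(t)=t^i$ for $i\ge 0$; thus $H((e_1-x)^2;x)$ denotes $H$ applied to the function $t\mapsto (t-x)^2$ (with $x$ fixed) and evaluated at the point $x$. Bernstein operator: for an integer $n\ge1$, $B_n(f;x)=\sum_{k=0}^n f(k/n)\binom{n}{k}x^k(1-x)^{n-k}$. Euler-Jacobi Beta operator: for $r>0$, $a,b\ge-1$, $f\in C[0,1]$ and $x\in[0,1]$, $$\mathcal{B}^{a,b}_r(f;x)=\frac{\int_0^1 t^{rx+a}(1-t)^{r(1-x)+b}f(t)\,dt}{\int_0^1 t^{rx+a}(1-t)^{r(1-x)+b}\,dt},$$ except that if $a=-1$ then $\mathcal{B}^{a,b}_r(f;0):=f(0)$, and if $b=-1$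 then $\mathcal{B}^{a,b}_r(f;1):=f(1)$. The operator $\mathcal{B}^{c,d}_s$ is defined by the same formula with $(r,a,b)$ replaced by $(s,c,d)$. Composition is read as $(\mathcal{B}^{c,d}_s\circ B_n\circ\mathcal{B}^{a,b}_r)f=\mathcal{B}^{c,d}_s(B_n(\mathcal{B}^{a,b}_rf))$. Modulus of continuity: $\omega(f;t)=\sup\{|f(u)-f(v)|: u,v\in[0,1],\ |u-v|\le t\}$ for $t\ge0$. Its least concave majorant $\widetilde\omega(f;\cdot)$ is the smallest concave function on $[0,\infty)$ that is $\ge\omega(f;\cdot)$; equivalently $\widetilde\omega(f;t)=\sup_{0\le u\le t\le v\le 1,\,u\ne v}\frac{(t-u)\omega(f;v)+(v-t)\omega(f;u)}{v-u}$ for $0\le t\le1$ and $\widetilde\omega(f;t)=\omega(f;1)$ for $t>1$. *)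

theory Defs
  imports "HOL-Analysis.Analysis"
begin

text \<open>Elements of \<open>C[0,1]\<close> are represented by functions \<open>real \<Rightarrow> real\<close> that are continuous on
  \<open>{0..1}\<close>. All notions below depend only on the restriction of the argument to \<open>{0..1}\<close>.\<close>

definition bernstein_op :: "nat \<Rightarrow> (real \<Rightarrow> real) \<Rightarrow> real \<Rightarrow> real" where
  "bernstein_op n f x = (\<Sum>k\<le>n. f (real k / real n) * Bernstein n k x)"

text \<open>Since \<open>0 powr p = 0\<close> for every \<open>p\<close>, the integrands may differ from the usual
  convention at the endpoints of the interval, which form a null set.\<close>

definition beta_op :: "real \<Rightarrow> real \<Rightarrow> real \<Rightarrow> (real \<Rightarrow> real) \<Rightarrow> real \<Rightarrow> real" where
  "beta_op r a b f x =
    (if a = -1 \<and> x = 0 then f 0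
     else if b = -1 \<and> x = 1 then f 1
     else (LINT t:{0..1}|lborel. t powr (r * x + a) * (1 - t) powr (r * (1 - x) + b) * f t) /
          (LINT t:{0..1}|lborel. t powr (r * x + a) * (1 - t) powr (r * (1 - x) + b)))"

definition bej2_op ::
  "real \<Rightarrow> real \<Rightarrow> real \<Rightarrow> nat \<Rightarrow> real \<Rightarrow> real \<Rightarrow> real \<Rightarrow> (real \<Rightarrow> real) \<Rightarrow> real \<Rightarrow> real" where
  "bej2_op s c d n r a b = beta_op s c d \<circ> bernstein_op n \<circ> beta_op r a b"

definition chebyshev_functional ::
  "((real \<Rightarrow> real) \<Rightarrow> real \<Rightarrow> real) \<Rightarrow> (real \<Rightarrow> real) \<Rightarrow> (real \<Rightarrow> real) \<Rightarrow> real \<Rightarrow> real" where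
  "chebyshev_functional H f g x = H (\<lambda>t. f t * g t) x - H f x * H g x"

definition modulus_cont :: "(real \<Rightarrow> real) \<Rightarrow> real \<Rightarrow> real" where
  "modulus_cont f t = Sup {\<bar>f u - f v\<bar> | u v. u \<in> {0..1} \<and> v \<in> {0..1} \<and> \<bar>u - v\<bar> \<le> t}"

definition concave_majorants :: "(real \<Rightarrow> real) \<Rightarrow> (real \<Rightarrow> real) set" where
  "concave_majorants w = {h. concave_on {0..} h \<and> (\<forall>u\<ge>0. w u \<le> h u)}"

text \<open>The pointwise infimum of all concave majorants of \<open>w\<close> on \<open>[0,\<infinity>)\<close>, relevant for
  \<open>t \<ge> 0\<close> only. The lemmas below show that, for \<open>w = modulus_cont f\<close>, it is
  itself a concave majorant and hence the smallest one.\<close>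

definition least_concave_majorant :: "(real \<Rightarrow> real) \<Rightarrow> real \<Rightarrow> real" where
  "least_concave_majorant w t = (INF h\<in>concave_majorants w. h t)"

definition modulus_cont_tilde :: "(real \<Rightarrow> real) \<Rightarrow> real \<Rightarrow> real" where
  "modulus_cont_tilde f = least_concave_majorant (modulus_cont f)"

lemma concave_majorants_modulus_nonempty:
  assumes "continuous_on {0..1} f"
  shows "concave_majorants (modulus_cont f) \<noteq> {}"
proof -
  have "bounded (f ` {0..1})"
    using assms by (intro compact_imp_bounded compact_continuous_image) auto
  then obtain M where M: "\<And>u. u \<in> {0..1} \<Longrightarrow> \<bar>f u\<bar> \<le> M"
    unfolding bounded_iff by (metis imageI real_norm_def)
  have "modulus_cont f t \<le> 2 * M" if "t \<ge> 0" for t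
    unfolding modulus_cont_def
  proof (rule cSup_least)
    have "\<bar>f 0 - f 0\<bar> \<in> {\<bar>f u - f v\<bar> | u v. u \<in> {0..1} \<and> v \<in> {0..1} \<and> \<bar>u - v\<bar> \<le> t}"
      using that by (intro CollectI exI[of _ 0]) auto
    then show "{\<bar>f u - f v\<bar> | u v. u \<in> {0..1} \<and> v \<in> {0..1} \<and> \<bar>u - v\<bar> \<le> t} \<noteq> {}"
      by blast
  next
    fix y assume "y \<in> {\<bar>f u - f v\<bar> | u v. u \<in> {0..1} \<and> v \<in> {0..1} \<and> \<bar>u - v\<bar> \<le> t}"
    then obtain u v where "y = \<bar>f u - f v\<bar>" "u \<in> {0..1}" "v \<in> {0..1}" by blast
    then show "y \<le> 2 * M" using M[of u] M[of v] by linarith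
  qed
  then have "(\<lambda>_. 2 * M) \<in> concave_majorants (modulus_cont f)"
    by (simp add: concave_majorants_def concave_on_const)
  then show ?thesis by blast
qed

lemma least_concave_majorant_lower:
  assumes "h \<in> concave_majorants w" "t \<ge> 0"
  shows "least_concave_majorant w t \<le> h t"
  unfolding least_concave_majorant_def
  using assms by (intro cINF_lower bdd_belowI2[of _ "w t"]) (auto simp: concave_majorants_def)

lemma least_concave_majorant_mem:
  assumes ne: "concave_majorants w \<noteq> {}"
  shows "least_concave_majorant w \<in> concave_majorants w"
proof -
  let ?L = "least_concave_majorant w"
  have "w t \<le> ?L t" if "t \<ge> 0" for t
    unfolding least_concave_majorant_def
    using ne that by (intro cINF_greatest) (auto simp: concave_majorants_def)
  moreover have "concave_on {0..} ?L"
    unfolding concave_on_iff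
  proof (intro conjI ballI allI impI)
    fix x y u v :: real
    assume *: "x \<in> {0..}" "y \<in> {0..}" "u \<ge> 0" "v \<ge> 0" "u + v = 1"
    have "u * ?L x + v * ?L y \<le> h (u *\<^sub>R x + v *\<^sub>R y)" if h: "h \<in> concave_majorants w" for h
    proof -
      have "u * ?L x + v * ?L y \<le> u * h x + v * h y"
        using * h by (intro add_mono mult_left_mono least_concave_majorant_lower) auto
      also have "\<dots> \<le> h (u *\<^sub>R x + v *\<^sub>R y)"
        using * h unfolding concave_majorants_def concave_on_iff by blast
      finally show ?thesis .
    qed
    then show "u * ?L x + v * ?L y \<le> ?L (u *\<^sub>R x + v *\<^sub>R y)"
      unfolding least_concave_majorant_def[of w "u *\<^sub>R x + v *\<^sub>R y"]
      using ne by (intro cINF_greatest)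
  qed auto
  ultimately show ?thesis by (simp add: concave_majorants_def)
qed

end

theory Submission
  imports Defs
begin

text \<open>
  For fixed \<open>x\<close>, the map \<open>L f = R(f; x)\<close> is a positive linear functional on \<open>C[0,1]\<close> with
  \<open>L 1 = 1\<close>, and the inequality holds for every such functional; it is a Gruess-type estimate.
  The form \<open>cov f g = L (f g) - L f * L g\<close> is positive semidefinite, so the Cauchy-Schwarz
  inequality (\<open>cov_Cauchy_Schwarz\<close>) reduces the claim to \<open>f = g\<close>, that is, to bounding the
  seminorm \<open>sqrt (cov f f)\<close> by half of the majorant at \<open>2 * \<sigma>\<close>, where
  \<open>\<sigma>\<^sup>2 = L ((t - x)\<^sup>2)\<close>.

  This seminorm is at most \<open>sup \<bar>f\<bar>\<close> in general and at most \<open>\<beta> * \<sigma>\<close> on \<open>\<beta>\<close>-Lipschitz functions.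
  If \<open>t \<mapsto> \<alpha> + \<beta> * t\<close> dominates the modulus of continuity of \<open>f\<close>, then \<open>f\<close> lies within
  \<open>\<alpha> / 2\<close> of a \<open>\<beta>\<close>-Lipschitz function (\<open>Lipschitz_approximation\<close>), whence
  \<open>sqrt (cov f f) \<le> \<alpha> / 2 + \<beta> * \<sigma>\<close> (\<open>sqrt_cov_le_affine\<close>). The right-hand side is half the value
  of the line at \<open>2 * \<sigma>\<close>, and for the supporting line of the concave majorant at \<open>2 * \<sigma>\<close>
  it is half the value of the majorant itself. If \<open>\<sigma> = 0\<close> there need not be a supporting line,
  but uniform continuity provides dominating lines with arbitrarily small \<open>\<alpha>\<close>.

  The functional \<open>R(f; x)\<close> is of this kind because \<open>f \<mapsto> beta_op r a b f x\<close> is one for each \<open>x\<close>: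
  a weighted average for an integrable weight, or a point evaluation in the exceptional
  cases. Inserting the Bernstein operator between two such families preserves the property,
  since it takes convex combinations of finitely many means and returns a polynomial.
\<close>

section \<open>Means on the unit interval\<close>

locale unit_interval_mean =
  fixes L :: "(real \<Rightarrow> real) \<Rightarrow> real"
  assumes one: "L (\<lambda>_. 1) = 1"
    and linear: "\<And>f g p q. continuous_on {0..1} f \<Longrightarrow> continuous_on {0..1} g \<Longrightarrow>
      L (\<lambda>t. p * f t + q * g t) = p * L f + q * L g"
    and nonneg: "\<And>f. continuous_on {0..1} f \<Longrightarrow> (\<And>t. t \<in> {0..1} \<Longrightarrow> 0 \<le> f t) \<Longrightarrow> 0 \<le> L f"
begin

definition cov :: "(real \<Rightarrow> real) \<Rightarrow> (real \<Rightarrow> real) \<Rightarrow> real" where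
  "cov f g = L (\<lambda>t. f t * g t) - L f * L g"

lemma mono:
  assumes f: "continuous_on {0..1} f" and g: "continuous_on {0..1} g"
    and le: "\<And>t. t \<in> {0..1} \<Longrightarrow> f t \<le> g t"
  shows "L f \<le> L g"
proof -
  have "0 \<le> L (\<lambda>t. 1 * g t + (-1) * f t)"
    using f g le by (intro nonneg continuous_intros) auto
  then show ?thesis
    using linear[OF g f, of 1 "-1"] by simp
qed

lemma scale: "continuous_on {0..1} f \<Longrightarrow> L (\<lambda>t. p * f t) = p * L f"
  using linear[of f f p 0] by simp

lemma const: "L (\<lambda>_. p) = p"
  using scale[of "\<lambda>_. 1" p] one by simp

text \<open>The Steiner (parallel axis) identity. The choice \<open>m = L f\<close> shows that \<open>cov\<close> is positive
  semidefinite; other values of \<open>m\<close> give upper bounds for \<open>cov f f\<close>.\<close>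

lemma cov_self_shift:
  assumes f: "continuous_on {0..1} f"
  shows "cov f f = L (\<lambda>t. (f t - m)\<^sup>2) - (L f - m)\<^sup>2"
proof -
  have "L (\<lambda>t. (f t - m)\<^sup>2) = L (\<lambda>t. 1 * (1 * (f t * f t) + (- 2 * m) * f t) + m\<^sup>2 * 1)"
    by (rule arg_cong[where f = L]) (auto simp: power2_eq_square algebra_simps)
  also have "\<dots> = 1 * L (\<lambda>t. 1 * (f t * f t) + (- 2 * m) * f t) + m\<^sup>2 * L (\<lambda>_. 1)"
    using f by (intro linear continuous_intros)
  also have "L (\<lambda>t. 1 * (f t * f t) + (- 2 * m) * f t) = 1 * L (\<lambda>t. f t * f t) + (- 2 * m) * L f"
    using f by (intro linear continuous_intros)
  finally show ?thesis
    by (simp add: cov_def one power2_eq_square algebra_simps)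
qed

lemma cov_self_nonneg:
  assumes f: "continuous_on {0..1} f"
  shows "0 \<le> cov f f"
proof -
  have "0 \<le> L (\<lambda>t. (f t - L f)\<^sup>2)"
    using f by (intro nonneg continuous_intros) auto
  then show ?thesis
    using cov_self_shift[OF f, of "L f"] by simp
qed

lemma cov_self_le:
  assumes f: "continuous_on {0..1} f" and g: "continuous_on {0..1} g"
    and le: "\<And>t. t \<in> {0..1} \<Longrightarrow> (f t - m)\<^sup>2 \<le> g t"
  shows "cov f f \<le> L g"
proof -
  have "L (\<lambda>t. (f t - m)\<^sup>2) \<le> L g"
    using f g le by (intro mono continuous_intros) auto
  then show ?thesis
    using cov_self_shift[OF f, of m] by (smt (verit) zero_le_power2)
qed

lemma cov_combination:
  assumes f: "continuous_on {0..1} f" and g: "continuous_on {0..1} g"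
  shows "cov (\<lambda>t. p * f t + q * g t) (\<lambda>t. p * f t + q * g t)
    = p\<^sup>2 * cov f f + 2 * p * q * cov f g + q\<^sup>2 * cov g g"
proof -
  have "L (\<lambda>t. (p * f t + q * g t) * (p * f t + q * g t))
      = L (\<lambda>t. 1 * (p\<^sup>2 * (f t * f t) + (2 * p * q) * (f t * g t)) + q\<^sup>2 * (g t * g t))"
    by (rule arg_cong[where f = L]) (auto simp: power2_eq_square algebra_simps)
  also have "\<dots> = 1 * L (\<lambda>t. p\<^sup>2 * (f t * f t) + (2 * p * q) * (f t * g t)) + q\<^sup>2 * L (\<lambda>t. g t * g t)"
    using f g by (intro linear continuous_intros)
  also have "L (\<lambda>t. p\<^sup>2 * (f t * f t) + (2 * p * q) * (f t * g t))
      = p\<^sup>2 * L (\<lambda>t. f t * f t) + (2 * p * q) * L (\<lambda>t. f t * g t)"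
    using f g by (intro linear continuous_intros)
  finally show ?thesis
    by (simp add: cov_def linear[OF f g] power2_eq_square algebra_simps)
qed

lemma cov_Cauchy_Schwarz:
  assumes f: "continuous_on {0..1} f" and g: "continuous_on {0..1} g"
  shows "\<bar>cov f g\<bar> \<le> sqrt (cov f f) * sqrt (cov g g)"
proof -
  define A B C where "A = cov f f" and "B = cov g g" and "C = cov f g"
  have psd: "0 \<le> p\<^sup>2 * A + 2 * p * q * C + q\<^sup>2 * B" for p q
    unfolding A_def B_def C_def cov_combination[OF f g, symmetric]
    using f g by (intro cov_self_nonneg continuous_intros)
  have "0 \<le> A" and "0 \<le> B"
    using psd[of 1 0] psd[of 0 1] by simp_all
  have "C\<^sup>2 \<le> A * B"
  proof (cases "B = 0")
    case True
    have "C = 0"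
    proof (rule ccontr)
      assume "C \<noteq> 0"
      \<comment> \<open>With \<open>B = 0\<close> the form is affine in its second coefficient, and this choice gives it
        the value \<open>-1\<close>.\<close>
      then show False
        using psd[of 1 "- (A + 1) / (2 * C)"] True by (simp add: field_simps)
    qed
    then show ?thesis
      using True by simp
  next
    case False
    have "0 \<le> B * (A * B - C\<^sup>2)"
      using psd[of B "- C"] by (simp add: power2_eq_square algebra_simps)
    then show ?thesis
      using False \<open>0 \<le> B\<close> by (simp add: zero_le_mult_iff)
  qed
  then have "sqrt (C\<^sup>2) \<le> sqrt (A * B)"
    by (rule real_sqrt_le_mono)
  then have "\<bar>C\<bar> \<le> sqrt A * sqrt B"
    by (simp only: real_sqrt_abs real_sqrt_mult)
  then show ?thesis
    by (simp only: A_def B_def C_def)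
qed

lemma sqrt_cov_triangle:
  assumes f: "continuous_on {0..1} f" and g: "continuous_on {0..1} g"
  shows "sqrt (cov (\<lambda>t. f t + g t) (\<lambda>t. f t + g t)) \<le> sqrt (cov f f) + sqrt (cov g g)"
proof (rule real_le_lsqrt)
  have "cov (\<lambda>t. f t + g t) (\<lambda>t. f t + g t) = cov f f + 2 * cov f g + cov g g"
    using cov_combination[OF f g, of 1 1] by simp
  also have "\<dots> \<le> (sqrt (cov f f) + sqrt (cov g g))\<^sup>2"
    using cov_Cauchy_Schwarz[OF f g] cov_self_nonneg[OF f] cov_self_nonneg[OF g]
    by (simp add: power2_sum)
  finally show "cov (\<lambda>t. f t + g t) (\<lambda>t. f t + g t) \<le> (sqrt (cov f f) + sqrt (cov g g))\<^sup>2" .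
qed (simp add: cov_self_nonneg f g)

end

section \<open>Lipschitz approximation and supporting lines\<close>

text \<open>The function \<open>H\<close> is the smallest \<open>\<beta>\<close>-Lipschitz majorant of \<open>f\<close> (a sup-convolution). The
  oscillation bound gives \<open>f \<le> H \<le> f + \<alpha>\<close>, so lowering \<open>H\<close> by \<open>\<alpha> / 2\<close> centres the error and
  halves it; this is where the factor \<open>1 / 2\<close> in the bound for \<open>sqrt (cov f f)\<close> originates.\<close>

lemma Lipschitz_approximation:
  fixes f :: "real \<Rightarrow> real"
  assumes "0 \<le> \<beta>" and "S \<noteq> {}"
    and osc: "\<And>u v. u \<in> S \<Longrightarrow> v \<in> S \<Longrightarrow> \<bar>f u - f v\<bar> \<le> \<alpha> + \<beta> * \<bar>u - v\<bar>"
  obtains h where "\<beta>-lipschitz_on S h" and "\<And>u. u \<in> S \<Longrightarrow> \<bar>f u - h u\<bar> \<le> \<alpha> / 2"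
proof -
  define H where "H u = (SUP v\<in>S. f v - \<beta> * \<bar>u - v\<bar>)" for u
  have upper: "f v - \<beta> * \<bar>u - v\<bar> \<le> f u + \<alpha>" if "u \<in> S" "v \<in> S" for u v
    using osc[OF that] by linarith
  then have bdd: "bdd_above ((\<lambda>v. f v - \<beta> * \<bar>u - v\<bar>) ` S)" if "u \<in> S" for u
    using that by (intro bdd_aboveI2) auto
  have ge: "f u \<le> H u" if u: "u \<in> S" for u
    using cSUP_upper[OF u bdd[OF u]] by (simp add: H_def)
  have le: "H u \<le> f u + \<alpha>" if u: "u \<in> S" for u
    unfolding H_def by (rule cSUP_least[OF \<open>S \<noteq> {}\<close> upper[OF u]])
  have one_sided: "H u \<le> H v + \<beta> * \<bar>u - v\<bar>" if u: "u \<in> S" and v: "v \<in> S" for u v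
    unfolding H_def[of u]
  proof (rule cSUP_least)
    fix w assume w: "w \<in> S"
    have "f w - \<beta> * \<bar>v - w\<bar> \<le> H v"
      unfolding H_def by (rule cSUP_upper[OF w bdd[OF v]])
    moreover have "\<beta> * \<bar>v - w\<bar> \<le> \<beta> * (\<bar>u - w\<bar> + \<bar>u - v\<bar>)"
      using \<open>0 \<le> \<beta>\<close> by (intro mult_left_mono) auto
    ultimately show "f w - \<beta> * \<bar>u - w\<bar> \<le> H v + \<beta> * \<bar>u - v\<bar>"
      by (simp add: algebra_simps)
  qed fact
  have "\<beta>-lipschitz_on S (\<lambda>u. H u - \<alpha> / 2)"
  proof (rule lipschitz_onI)
    fix u v assume "u \<in> S" "v \<in> S"
    then show "dist (H u - \<alpha> / 2) (H v - \<alpha> / 2) \<le> \<beta> * dist u v"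
      using one_sided[of u v] one_sided[of v u] by (simp add: dist_real_def abs_minus_commute abs_le_iff)
  qed fact
  moreover have "\<bar>f u - (H u - \<alpha> / 2)\<bar> \<le> \<alpha> / 2" if "u \<in> S" for u
    using ge[OF that] le[OF that] by (simp add: abs_le_iff field_simps)
  ultimately show thesis
    using that by blast
qed

text \<open>The slope is nonnegative because a line of negative slope eventually becomes negative and
  then cannot dominate \<open>w\<close>. A nonnegative slope is needed for use as a Lipschitz constant.\<close>

lemma concave_nonneg_supporting_line:
  fixes w :: "real \<Rightarrow> real"
  assumes conc: "concave_on {0..} w" and nonneg: "\<And>t. 0 \<le> t \<Longrightarrow> 0 \<le> w t" and "0 < t0"
  obtains \<alpha> \<beta> where "0 \<le> \<beta>" and "w t0 = \<alpha> + \<beta> * t0"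
    and "\<And>t. 0 \<le> t \<Longrightarrow> w t \<le> \<alpha> + \<beta> * t"
proof -
  have "convex_on {0..} (\<lambda>t. - w t)"
    using conc by (simp add: concave_on_def)
  moreover have "t0 \<in> interior {0..}"
    using \<open>0 < t0\<close> by simp
  ultimately obtain m where m: "\<And>t. 0 \<le> t \<Longrightarrow> - w t0 + m * (t - t0) \<le> - w t"
    using convex_le_Inf_differential[of "{0..}" "\<lambda>t. - w t" t0] by (meson atLeast_iff)
  have "0 \<le> - m"
  proof (rule ccontr)
    assume "\<not> 0 \<le> - m"
    then have "0 < m" by simp
    \<comment> \<open>The point where the line of slope \<open>- m\<close> through \<open>(t0, w t0)\<close> takes the value \<open>-1\<close>.\<close>
    define t where "t = t0 + (w t0 + 1) / m"
    have "0 \<le> t"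
      using \<open>0 < m\<close> \<open>0 < t0\<close> nonneg[of t0] by (simp add: t_def)
    moreover have "m * (t - t0) = w t0 + 1"
      using \<open>0 < m\<close> by (simp add: t_def)
    ultimately show False
      using m[of t] nonneg[of t] by linarith
  qed
  then show thesis
    using m by (intro that[of "- m" "w t0 + m * t0"]) (auto simp: algebra_simps)
qed

section \<open>The modulus of continuity and its majorant\<close>

lemma continuous_on_unit_interval_bounded:
  fixes f :: "real \<Rightarrow> real"
  assumes f: "continuous_on {0..1} f"
  obtains M where "\<And>u. u \<in> {0..1} \<Longrightarrow> \<bar>f u\<bar> \<le> M"
proof -
  have "bounded (f ` {0..1})"
    using f by (intro compact_imp_bounded compact_continuous_image) auto
  then show thesis
    using that unfolding bounded_iff by (metis imageI real_norm_def)
qed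

lemma modulus_cont_ge:
  assumes f: "continuous_on {0..1} f" and u: "u \<in> {0..1}" and v: "v \<in> {0..1}"
    and uv: "\<bar>u - v\<bar> \<le> t"
  shows "\<bar>f u - f v\<bar> \<le> modulus_cont f t"
  unfolding modulus_cont_def
proof (rule cSup_upper)
  obtain M where M: "\<And>u. u \<in> {0..1} \<Longrightarrow> \<bar>f u\<bar> \<le> M"
    using continuous_on_unit_interval_bounded[OF f] by blast
  show "bdd_above {\<bar>f u - f v\<bar> | u v. u \<in> {0..1} \<and> v \<in> {0..1} \<and> \<bar>u - v\<bar> \<le> t}"
  proof (rule bdd_aboveI)
    fix y assume "y \<in> {\<bar>f u - f v\<bar> | u v. u \<in> {0..1} \<and> v \<in> {0..1} \<and> \<bar>u - v\<bar> \<le> t}"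
    then obtain u v where "y = \<bar>f u - f v\<bar>" "u \<in> {0..1}" "v \<in> {0..1}" by blast
    then show "y \<le> 2 * M"
      using M[of u] M[of v] by linarith
  qed
qed (use u v uv in blast)

lemma modulus_cont_nonneg:
  assumes "continuous_on {0..1} f" and "0 \<le> t"
  shows "0 \<le> modulus_cont f t"
  using modulus_cont_ge[OF assms(1), of 0 0 t] assms(2) by simp

lemma modulus_cont_tilde_props:
  assumes "continuous_on {0..1} f"
  shows modulus_cont_tilde_concave: "concave_on {0..} (modulus_cont_tilde f)"
    and modulus_cont_tilde_ge: "\<And>t. 0 \<le> t \<Longrightarrow> modulus_cont f t \<le> modulus_cont_tilde f t"
  using least_concave_majorant_mem[OF concave_majorants_modulus_nonempty[OF assms]]
  by (auto simp: modulus_cont_tilde_def concave_majorants_def)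

section \<open>The Gruess inequality for means\<close>

context unit_interval_mean
begin

text \<open>For a Lipschitz approximation \<open>h\<close> of \<open>f\<close>, the triangle inequality applies to
  \<open>f = (f - h) + h\<close>: the first summand is uniformly small, and the second deviates from
  \<open>h x\<close> by at most \<open>\<beta> * \<bar>t - x\<bar>\<close>.\<close>

lemma sqrt_cov_le_affine:
  assumes f: "continuous_on {0..1} f" and "0 \<le> \<beta>" and x: "x \<in> {0..1}"
    and osc: "\<And>u v. u \<in> {0..1} \<Longrightarrow> v \<in> {0..1} \<Longrightarrow> \<bar>f u - f v\<bar> \<le> \<alpha> + \<beta> * \<bar>u - v\<bar>"
  shows "sqrt (cov f f) \<le> \<alpha> / 2 + \<beta> * sqrt (L (\<lambda>t. (t - x)\<^sup>2))"
proof -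
  have "0 \<le> \<alpha>"
    using osc[OF x x] by simp
  have nonempty: "{0..1::real} \<noteq> {}"
    by simp
  obtain h where lip: "\<beta>-lipschitz_on {0..1} h"
    and near: "\<And>u. u \<in> {0..1} \<Longrightarrow> \<bar>f u - h u\<bar> \<le> \<alpha> / 2"
    using Lipschitz_approximation[OF \<open>0 \<le> \<beta>\<close> nonempty osc] by metis
  have h: "continuous_on {0..1} h"
    by (rule lipschitz_on_continuous_on[OF lip])
  let ?e = "\<lambda>t. f t - h t"
  have e: "continuous_on {0..1} ?e"
    using f h by (intro continuous_intros)
  have "cov ?e ?e \<le> L (\<lambda>_. (\<alpha> / 2)\<^sup>2)"
  proof (rule cov_self_le[where m = 0])
    fix t :: real assume "t \<in> {0..1}"
    then show "(?e t - 0)\<^sup>2 \<le> (\<alpha> / 2)\<^sup>2"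
      using near[of t] \<open>0 \<le> \<alpha>\<close> by (simp add: abs_le_square_iff[symmetric])
  qed (use e in auto)
  then have sd_e: "sqrt (cov ?e ?e) \<le> \<alpha> / 2"
    using \<open>0 \<le> \<alpha>\<close> by (intro real_le_lsqrt) (auto simp: const)
  have "cov h h \<le> L (\<lambda>t. \<beta>\<^sup>2 * (t - x)\<^sup>2)"
  proof (rule cov_self_le[where m = "h x"])
    fix t :: real assume "t \<in> {0..1}"
    then have "\<bar>h t - h x\<bar> \<le> \<bar>\<beta> * (t - x)\<bar>"
      using lipschitz_onD[OF lip _ x, of t] \<open>0 \<le> \<beta>\<close> by (simp add: dist_real_def abs_mult)
    then show "(h t - h x)\<^sup>2 \<le> \<beta>\<^sup>2 * (t - x)\<^sup>2"
      by (simp add: abs_le_square_iff power_mult_distrib)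
  qed (intro h continuous_intros)+
  also have "\<dots> = \<beta>\<^sup>2 * L (\<lambda>t. (t - x)\<^sup>2)"
    by (intro scale continuous_intros)
  finally have "sqrt (cov h h) \<le> sqrt (\<beta>\<^sup>2 * L (\<lambda>t. (t - x)\<^sup>2))"
    by simp
  also have "\<dots> = \<beta> * sqrt (L (\<lambda>t. (t - x)\<^sup>2))"
    using \<open>0 \<le> \<beta>\<close> by (simp add: real_sqrt_mult)
  finally have sd_h: "sqrt (cov h h) \<le> \<beta> * sqrt (L (\<lambda>t. (t - x)\<^sup>2))" .
  have "sqrt (cov f f) \<le> sqrt (cov ?e ?e) + sqrt (cov h h)"
    using sqrt_cov_triangle[OF e h] by simp
  then show ?thesis
    using sd_e sd_h by linarith
qed

lemma sqrt_cov_le_modulus: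
  assumes f: "continuous_on {0..1} f" and x: "x \<in> {0..1}"
  shows "sqrt (cov f f) \<le> 1 / 2 * modulus_cont_tilde f (2 * sqrt (L (\<lambda>t. (t - x)\<^sup>2)))"
proof -
  define \<sigma> where "\<sigma> = sqrt (L (\<lambda>t. (t - x)\<^sup>2))"
  have "0 \<le> \<sigma>"
    unfolding \<sigma>_def by (intro real_sqrt_ge_zero nonneg continuous_intros) simp
  have tilde_nonneg: "0 \<le> modulus_cont_tilde f t" if "0 \<le> t" for t
    using modulus_cont_nonneg[OF f that] modulus_cont_tilde_ge[OF f that] by linarith
  have "sqrt (cov f f) \<le> 1 / 2 * modulus_cont_tilde f (2 * \<sigma>)"
  proof (cases "\<sigma> = 0")
    case False
    then have pos: "0 < 2 * \<sigma>"
      using \<open>0 \<le> \<sigma>\<close> by simp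
    obtain \<alpha> \<beta> where "0 \<le> \<beta>" and touch: "modulus_cont_tilde f (2 * \<sigma>) = \<alpha> + \<beta> * (2 * \<sigma>)"
      and above: "\<And>t. 0 \<le> t \<Longrightarrow> modulus_cont_tilde f t \<le> \<alpha> + \<beta> * t"
      using concave_nonneg_supporting_line[OF modulus_cont_tilde_concave[OF f] tilde_nonneg pos] by metis
    have "\<bar>f u - f v\<bar> \<le> \<alpha> + \<beta> * \<bar>u - v\<bar>" if "u \<in> {0..1}" "v \<in> {0..1}" for u v
      using modulus_cont_ge[OF f that order_refl] modulus_cont_tilde_ge[OF f, of "\<bar>u - v\<bar>"]
        above[of "\<bar>u - v\<bar>"] by simp
    from sqrt_cov_le_affine[OF f \<open>0 \<le> \<beta>\<close> x this]
    show ?thesis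
      using touch by (simp add: \<sigma>_def)
  next
    case True
    \<comment> \<open>Only the value at 0 of a dominating line enters the bound, and a steep line can have an
      arbitrarily small one.\<close>
    have "sqrt (cov f f) \<le> 0"
    proof (rule field_le_epsilon)
      fix e :: real assume "0 < e"
      have "uniformly_continuous_on {0..1} f"
        using f by (intro compact_uniformly_continuous) auto
      then obtain \<delta> where "0 < \<delta>"
        and \<delta>: "\<And>u v. u \<in> {0..1} \<Longrightarrow> v \<in> {0..1} \<Longrightarrow> \<bar>u - v\<bar> < \<delta> \<Longrightarrow> \<bar>f u - f v\<bar> < e"
        using \<open>0 < e\<close> unfolding uniformly_continuous_on_def dist_real_def by metis
      obtain M where M: "\<And>u. u \<in> {0..1} \<Longrightarrow> \<bar>f u\<bar> \<le> M"
        using continuous_on_unit_interval_bounded[OF f] by blast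
      have "0 \<le> M"
        using M[OF x] by linarith
      have "\<bar>f u - f v\<bar> \<le> e + 2 * M / \<delta> * \<bar>u - v\<bar>" if uv: "u \<in> {0..1}" "v \<in> {0..1}" for u v
      proof (cases "\<bar>u - v\<bar> < \<delta>")
        case True
        moreover have "0 \<le> 2 * M / \<delta> * \<bar>u - v\<bar>"
          using \<open>0 \<le> M\<close> \<open>0 < \<delta>\<close> by simp
        ultimately show ?thesis
          using \<delta>[OF uv True] by linarith
      next
        case False
        then have "2 * M / \<delta> * \<delta> \<le> 2 * M / \<delta> * \<bar>u - v\<bar>"
          using \<open>0 \<le> M\<close> \<open>0 < \<delta>\<close> by (intro mult_left_mono) auto
        then show ?thesis
          using M[OF uv(1)] M[OF uv(2)] \<open>0 < e\<close> \<open>0 < \<delta>\<close> by simp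
      qed
      from sqrt_cov_le_affine[OF f _ x this]
      show "sqrt (cov f f) \<le> 0 + e"
        using True \<open>0 < e\<close> \<open>0 \<le> M\<close> \<open>0 < \<delta>\<close> by (simp add: \<sigma>_def)
    qed
    then show ?thesis
      using tilde_nonneg[of "2 * \<sigma>"] \<open>0 \<le> \<sigma>\<close> by linarith
  qed
  then show ?thesis
    by (simp add: \<sigma>_def)
qed

theorem cov_le_moduli:
  assumes f: "continuous_on {0..1} f" and g: "continuous_on {0..1} g" and x: "x \<in> {0..1}"
  shows "\<bar>cov f g\<bar> \<le> 1 / 4
      * modulus_cont_tilde f (2 * sqrt (L (\<lambda>t. (t - x)\<^sup>2)))
      * modulus_cont_tilde g (2 * sqrt (L (\<lambda>t. (t - x)\<^sup>2)))"
proof -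
  have "\<bar>cov f g\<bar> \<le> sqrt (cov f f) * sqrt (cov g g)"
    by (rule cov_Cauchy_Schwarz[OF f g])
  also have "\<dots> \<le> (1 / 2 * modulus_cont_tilde f (2 * sqrt (L (\<lambda>t. (t - x)\<^sup>2))))
      * (1 / 2 * modulus_cont_tilde g (2 * sqrt (L (\<lambda>t. (t - x)\<^sup>2))))"
    using sqrt_cov_le_modulus[OF f x] sqrt_cov_le_modulus[OF g x]
      cov_self_nonneg[OF f] cov_self_nonneg[OF g]
    by (intro mult_mono) (auto intro: order_trans[rotated])
  finally show ?thesis by simp
qed

end

section \<open>The Bernstein-Euler-Jacobi operator as a mean\<close>

lemma set_integrable_mult_continuous:
  fixes w f :: "real \<Rightarrow> real"
  assumes w: "set_integrable lborel {0..1} w" and f: "continuous_on {0..1} f"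
  shows "set_integrable lborel {0..1} (\<lambda>t. w t * f t)"
proof -
  obtain M where M: "\<And>u. u \<in> {0..1} \<Longrightarrow> \<bar>f u\<bar> \<le> M"
    using continuous_on_unit_interval_bounded[OF f] by blast
  have fm: "(\<lambda>t. indicator {0..1} t *\<^sub>R f t) \<in> borel_measurable lborel"
    using borel_measurable_continuous_on_indicator[OF _ f] by simp
  have wm: "(\<lambda>t. indicator {0..1} t *\<^sub>R w t) \<in> borel_measurable lborel"
    using w unfolding set_integrable_def by (rule borel_measurable_integrable)
  show ?thesis
  proof (rule set_integrable_bound)
    show "set_integrable lborel {0..1} (\<lambda>t. M * w t)"
      using w by simp
    have "(\<lambda>t. indicator {0..1} t *\<^sub>R (w t * f t))
        = (\<lambda>t. (indicator {0..1} t *\<^sub>R w t) * (indicator {0..1} t *\<^sub>R f t))"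
      by (auto simp: indicator_def)
    then show "set_borel_measurable lborel {0..1} (\<lambda>t. w t * f t)"
      unfolding set_borel_measurable_def using borel_measurable_times[OF wm fm] by simp
    have "norm (w t * f t) \<le> norm (M * w t)" if "t \<in> {0..1}" for t
      using mult_left_mono[OF M[OF that], of "\<bar>w t\<bar>"] M[OF that]
      by (simp add: abs_mult mult.commute)
    then show "AE t in lborel. t \<in> {0..1} \<longrightarrow> norm (w t * f t) \<le> norm (M * w t)"
      by simp
  qed
qed

lemma unit_interval_mean_eval:
  "x \<in> {0..1} \<Longrightarrow> unit_interval_mean (\<lambda>f. f x)"
  by unfold_locales auto

lemma unit_interval_mean_weighted:
  fixes w :: "real \<Rightarrow> real"
  assumes w: "set_integrable lborel {0..1} w" and nonneg: "\<And>t. t \<in> {0..1} \<Longrightarrow> 0 \<le> w t"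
    and pos: "0 < (LINT t:{0..1}|lborel. w t)"
  shows "unit_interval_mean (\<lambda>f. (LINT t:{0..1}|lborel. w t * f t) / (LINT t:{0..1}|lborel. w t))"
proof
  fix f g :: "real \<Rightarrow> real" and p q :: real
  assume f: "continuous_on {0..1} f" and g: "continuous_on {0..1} g"
  note int = set_integrable_mult_continuous[OF w f] set_integrable_mult_continuous[OF w g]
  have "(LINT t:{0..1}|lborel. w t * (p * f t + q * g t))
      = (LINT t:{0..1}|lborel. p * (w t * f t) + q * (w t * g t))"
    by (simp add: algebra_simps)
  also have "\<dots> = p * (LINT t:{0..1}|lborel. w t * f t) + q * (LINT t:{0..1}|lborel. w t * g t)"
    using int by (subst set_integral_add(2)) auto
  finally show "(LINT t:{0..1}|lborel. w t * (p * f t + q * g t)) / (LINT t:{0..1}|lborel. w t)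
      = p * ((LINT t:{0..1}|lborel. w t * f t) / (LINT t:{0..1}|lborel. w t))
        + q * ((LINT t:{0..1}|lborel. w t * g t) / (LINT t:{0..1}|lborel. w t))"
    by (simp add: add_divide_distrib)
next
  fix f :: "real \<Rightarrow> real"
  assume "\<And>t. t \<in> {0..1} \<Longrightarrow> 0 \<le> f t"
  then have "0 \<le> (LINT t:{0..1}|lborel. w t * f t)"
    unfolding set_lebesgue_integral_def using nonneg
    by (intro Bochner_Integration.integral_nonneg) (auto simp: indicator_def)
  then show "0 \<le> (LINT t:{0..1}|lborel. w t * f t) / (LINT t:{0..1}|lborel. w t)"
    using pos by simp
qed (use pos in simp)

text \<open>Outside the two exceptional cases both exponents exceed \<open>-1\<close>, so the weight is the
  integrand of Euler's Beta function and its total mass is finite and positive.\<close>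

lemma unit_interval_mean_beta_op:
  assumes "0 < r" and "-1 \<le> a" and "-1 \<le> b" and x: "x \<in> {0..1}"
  shows "unit_interval_mean (\<lambda>f. beta_op r a b f x)"
proof -
  consider "a = -1 \<and> x = 0" | "\<not> (a = -1 \<and> x = 0)" "b = -1 \<and> x = 1"
    | "\<not> (a = -1 \<and> x = 0)" "\<not> (b = -1 \<and> x = 1)"
    by blast
  then show ?thesis
  proof cases
    case 1
    then show ?thesis
      using unit_interval_mean_eval[of 0] by (simp add: beta_op_def)
  next
    case 2
    then show ?thesis
      using unit_interval_mean_eval[of 1] by (simp add: beta_op_def)
  next
    case 3
    define p q where "p = r * x + a + 1" and "q = r * (1 - x) + b + 1"
    have "0 < p"
    proof (cases "x = 0")
      case False
      then have "0 < r * x"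
        using x \<open>0 < r\<close> by simp
      then show ?thesis
        using \<open>-1 \<le> a\<close> by (simp add: p_def)
    qed (use 3 \<open>-1 \<le> a\<close> in \<open>auto simp: p_def\<close>)
    have "0 < q"
    proof (cases "x = 1")
      case False
      then have "0 < r * (1 - x)"
        using x \<open>0 < r\<close> by simp
      then show ?thesis
        using \<open>-1 \<le> b\<close> by (simp add: q_def)
    qed (use 3 \<open>-1 \<le> b\<close> in \<open>auto simp: q_def\<close>)
    define w where "w t = t powr (r * x + a) * (1 - t) powr (r * (1 - x) + b)" for t
    have w_eq: "w = (\<lambda>t. t powr (p - 1) * (1 - t) powr (q - 1))"
      by (simp add: w_def p_def q_def fun_eq_iff)
    have int: "set_integrable lborel {0..1} w"
      unfolding w_eq by (rule integrable_Beta[OF \<open>0 < p\<close> \<open>0 < q\<close>])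
    have "(LINT t:{0..1}|lborel. w t) = integral {0..1} w"
      using int by (rule set_borel_integral_eq_integral)
    also have "\<dots> = Beta p q"
      unfolding w_eq by (rule integral_unique[OF has_integral_Beta_real[OF \<open>0 < p\<close> \<open>0 < q\<close>]])
    also have "\<dots> > 0"
      using \<open>0 < p\<close> \<open>0 < q\<close> by (simp add: Beta_def)
    finally have "unit_interval_mean
        (\<lambda>f. (LINT t:{0..1}|lborel. w t * f t) / (LINT t:{0..1}|lborel. w t))"
      by (intro unit_interval_mean_weighted int) (auto simp: w_def)
    moreover have "beta_op r a b f x
        = (LINT t:{0..1}|lborel. w t * f t) / (LINT t:{0..1}|lborel. w t)" for f
      using 3 by (auto simp: beta_op_def w_def)
    ultimately show ?thesis
      by simp
  qed
qed

lemma continuous_on_bernstein_op: "continuous_on S (bernstein_op n f)"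
  unfolding bernstein_op_def Bernstein_def by (intro continuous_intros)

text \<open>The Bernstein operator forms convex combinations of the means \<open>\<lambda>f. H f (k / n)\<close>, and its
  output is a polynomial, hence in the domain on which \<open>L\<close> is linear and positive.\<close>

lemma unit_interval_mean_compose_bernstein:
  assumes L: "unit_interval_mean L" and H: "\<And>x. x \<in> {0..1} \<Longrightarrow> unit_interval_mean (\<lambda>f. H f x)"
  shows "unit_interval_mean (\<lambda>f. L (bernstein_op n (H f)))"
proof
  have node: "real k / real n \<in> {0..1}" if "k \<le> n" for k
    using that by (auto simp: divide_le_eq)
  note Hk = H[OF node]
  have "bernstein_op n (H (\<lambda>_. 1)) = (\<lambda>_. 1)"
    using unit_interval_mean.one[OF Hk] by (simp add: bernstein_op_def fun_eq_iff)
  then show "L (bernstein_op n (H (\<lambda>_. 1))) = 1"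
    using unit_interval_mean.one[OF L] by simp
  show "L (bernstein_op n (H (\<lambda>t. p * f t + q * g t)))
      = p * L (bernstein_op n (H f)) + q * L (bernstein_op n (H g))"
    if "continuous_on {0..1} f" "continuous_on {0..1} g" for f g p q
  proof -
    have "bernstein_op n (H (\<lambda>t. p * f t + q * g t))
        = (\<lambda>y. p * bernstein_op n (H f) y + q * bernstein_op n (H g) y)"
      using unit_interval_mean.linear[OF Hk that]
      by (simp add: bernstein_op_def fun_eq_iff sum_distrib_left sum.distrib[symmetric] algebra_simps)
    then show ?thesis
      by (simp add: unit_interval_mean.linear[OF L] continuous_on_bernstein_op)
  qed
  show "0 \<le> L (bernstein_op n (H f))"
    if "continuous_on {0..1} f" "\<And>t. t \<in> {0..1} \<Longrightarrow> 0 \<le> f t" for f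
    using unit_interval_mean.nonneg[OF Hk that]
    by (intro unit_interval_mean.nonneg[OF L] continuous_on_bernstein_op)
      (auto simp: bernstein_op_def intro!: sum_nonneg mult_nonneg_nonneg Bernstein_nonneg)
qed

theorem mainTheorem2:
  fixes r s a b c d :: real and n :: nat and f g :: "real \<Rightarrow> real" and x :: real
  assumes "r > 0" and "s > 0"
    and "a \<ge> -1" and "b \<ge> -1" and "c \<ge> -1" and "d \<ge> -1"
    and "n > 1"
    and "continuous_on {0..1} f" and "continuous_on {0..1} g"
    and "x \<in> {0..1}"
  shows "\<bar>chebyshev_functional (bej2_op s c d n r a b) f g x\<bar>
    \<le> 1 / 4
      * modulus_cont_tilde f (2 * sqrt (bej2_op s c d n r a b (\<lambda>t. (t - x)\<^sup>2) x))
      * modulus_cont_tilde g (2 * sqrt (bej2_op s c d n r a b (\<lambda>t. (t - x)\<^sup>2) x))"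
proof -
  have "unit_interval_mean (\<lambda>f. beta_op s c d (bernstein_op n (beta_op r a b f)) x)"
    using assms
    by (intro unit_interval_mean_compose_bernstein[of "\<lambda>h. beta_op s c d h x"]
        unit_interval_mean_beta_op)
  then interpret unit_interval_mean "\<lambda>f. bej2_op s c d n r a b f x"
    by (simp add: bej2_op_def)
  have "chebyshev_functional (bej2_op s c d n r a b) f g x = cov f g"
    by (simp add: chebyshev_functional_def cov_def)
  then show ?thesis
    using cov_le_moduli assms by simp
qed

end
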